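(* (1) For every $m\in\mathbb{N}_0$ there is $C>0$ such that for all $y>0$, $\displaystyle\sum_{j\in\mathbb{Z}}|\partial_y^mP(y,j)|=\|\partial_y^mP(y,\cdot)\|_1\le Cy^{-m}$. (2) For every $l\in\mathbb{N}_0$ there is $C>0$ such that for all $y>0$, $\displaystyle\sum_{j\in\mathbb{Z}}|\delta_{right}^lP(y,j)|=\|\delta_{right}^lP(y,\cdot)\|_1\le Cy^{-l}$.
   Context: $G(t,n)=e^{-2t}I_n(2t)$ for $t>0$, $n\in\mathbb{Z}$, is the discrete heat kernel, where $I_n(t)=\sum_{m=0}^\infty\frac{1}{m!\,\Gamma(m+n+1)}(t/2)^{2m+n}$ for $n\in\mathbb{N}_0$ and $I_{-n}=I_n$. The discrete Poisson kernel is $P(y,j)=\frac{y}{2\sqrt\pi}\int_0^\infty\frac{e^{-y^2/(4t)}}{t^{3/2}}G(t,j)\,dt$, $y>0$, $j\in\mathbb{Z}$. $\delta_{right}f(j)=f(j)-f(j+1)$ acts in the integer variable, and $\delta_{right}^l$ is its $l$-th iterate. *)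

theory Defs
  imports "HOL-Analysis.Analysis"
begin

text \<open>Modified Bessel function of the first kind of integer order. The order enters only
  through its absolute value, so that the order \<open>-n\<close> gives the same function as \<open>n\<close>.\<close>

definition bessel_I :: "int \<Rightarrow> real \<Rightarrow> real" where
  "bessel_I n t =
     (\<Sum>m. 1 / (fact m * Gamma (real m + real (nat \<bar>n\<bar>) + 1)) * (t / 2) ^ (2 * m + nat \<bar>n\<bar>))"

definition heat_kernel :: "real \<Rightarrow> int \<Rightarrow> real" where
  "heat_kernel t n = exp (- 2 * t) * bessel_I n (2 * t)"

definition poisson_kernel :: "real \<Rightarrow> int \<Rightarrow> real" where
  "poisson_kernel y j =
     y / (2 * sqrt pi) *
       (LBINT t:{0<..}. exp (- y\<^sup>2 / (4 * t)) / t powr (3 / 2) * heat_kernel t j)"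

definition delta_right :: "(int \<Rightarrow> real) \<Rightarrow> int \<Rightarrow> real" where
  "delta_right f j = f j - f (j + 1)"

text \<open>The series and the integral above are convergent, so that the default values of
  \<^const>\<open>suminf\<close> and of the Lebesgue integral play no role.\<close>

lemma bessel_I_term:
  "1 / (fact m * Gamma (real m + real k + 1)) * (2 * t / 2) ^ (2 * m + k)
     = (t ^ m / fact m) * (t ^ (m + k) / fact (m + k))" for t :: real
proof -
  have "Gamma (real m + real k + 1) = fact (m + k)"
  proof -
    have "real m + real k + 1 = 1 + real (m + k)" by simp
    then show ?thesis by (simp only: Gamma_fact)
  qed
  moreover have "(2 * t / 2) ^ (2 * m + k) = t ^ m * t ^ (m + k)"
  proof -
    have "2 * t / 2 = t" "2 * m + k = m + (m + k)" by simp_all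
    then show ?thesis by (simp only: power_add)
  qed
  ultimately show ?thesis by simp
qed

lemma summable_bessel_I:
  fixes t :: real
  shows "summable (\<lambda>m. 1 / (fact m * Gamma (real m + real k + 1)) * (t / 2) ^ (2 * m + k))"
proof -
  define s where "s = t / 2"
  have e: "summable (\<lambda>m. \<bar>s\<bar> ^ m / fact m * exp \<bar>s\<bar>)"
    using summable_exp[of "\<bar>s\<bar>"] by (intro summable_mult2) (simp add: field_simps)
  have b: "x ^ i / fact i \<le> exp x" if "x \<ge> 0" for x :: real and i
  proof -
    have "sum (\<lambda>i. x ^ i / fact i) {i} \<le> (\<Sum>i. x ^ i / fact i)"
      using that summable_exp[of x] by (intro sum_le_suminf) (auto simp: field_simps)
    then show ?thesis by (simp add: exp_def divide_inverse_commute scaleR_conv_of_real)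
  qed
  have "summable (\<lambda>m. s ^ m / fact m * (s ^ (m + k) / fact (m + k)))"
  proof (rule summable_comparison_test'[OF e, of 0])
    fix m
    have "norm (s ^ m / fact m * (s ^ (m + k) / fact (m + k)))
            = \<bar>s\<bar> ^ m / fact m * (\<bar>s\<bar> ^ (m + k) / fact (m + k))"
      by (simp add: abs_mult power_abs)
    also have "\<dots> \<le> \<bar>s\<bar> ^ m / fact m * exp \<bar>s\<bar>"
      by (intro mult_left_mono b) auto
    finally show "norm (s ^ m / fact m * (s ^ (m + k) / fact (m + k)))
        \<le> \<bar>s\<bar> ^ m / fact m * exp \<bar>s\<bar>" .
  qed
  then show ?thesis using bessel_I_term[of _ k s] by (simp add: s_def)
qed

lemma heat_kernel_bounds:
  assumes "t \<ge> 0"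
  shows "0 \<le> heat_kernel t n" "heat_kernel t n \<le> 1"
proof -
  define k where "k = nat \<bar>n\<bar>"
  have ex: "(\<lambda>i. t ^ i / fact i) sums exp t"
    using exp_converges[of t] by (simp add: divide_inverse_commute)
  have b: "t ^ i / fact i \<le> exp t" for i
    using sum_le_suminf[of "\<lambda>i. t ^ i / fact i" "{i}"] ex assms by (auto simp: sums_iff)
  have I: "bessel_I n (2 * t) = (\<Sum>m. t ^ m / fact m * (t ^ (m + k) / fact (m + k)))"
    unfolding bessel_I_def k_def[symmetric] bessel_I_term ..
  have s: "summable (\<lambda>m. t ^ m / fact m * (t ^ (m + k) / fact (m + k)))"
    using summable_bessel_I[of k "2 * t"] unfolding bessel_I_term .
  have "bessel_I n (2 * t) \<le> (\<Sum>m. t ^ m / fact m * exp t)"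
    unfolding I using ex assms b
    by (intro suminf_le s summable_mult2 mult_left_mono) (auto simp: sums_iff)
  also have "\<dots> = exp t * exp t"
    using suminf_mult2[of "\<lambda>m. t ^ m / fact m" "exp t"] ex by (simp add: sums_iff)
  also have "\<dots> = exp (2 * t)" by (simp add: exp_add[symmetric])
  finally have "bessel_I n (2 * t) \<le> exp (2 * t)" .
  then show "heat_kernel t n \<le> 1"
    unfolding heat_kernel_def by (simp add: exp_minus field_simps)
  have "0 \<le> bessel_I n (2 * t)"
    unfolding I using assms by (intro suminf_nonneg s) auto
  then show "0 \<le> heat_kernel t n" by (simp add: heat_kernel_def)
qed

lemma borel_measurable_heat_kernel [measurable]: "(\<lambda>t. heat_kernel t n) \<in> borel_measurable borel"
proof -
  have "(\<lambda>t. bessel_I n (2 * t)) \<in> borel_measurable borel"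
    unfolding bessel_I_def by (intro borel_measurable_suminf) simp
  then show ?thesis unfolding heat_kernel_def by simp
qed

lemma poisson_kernel_integrable:
  assumes "y > 0"
  shows "set_integrable lborel {0<..}
           (\<lambda>t. exp (- y\<^sup>2 / (4 * t)) / t powr (3 / 2) * heat_kernel t j)"
proof -
  define f where "f t = exp (- y\<^sup>2 / (4 * t)) / t powr (3 / 2) * heat_kernel t j" for t
  have [measurable]: "f \<in> borel_measurable borel"
    unfolding f_def by measurable
  have sq: "x powr (3 / 2) \<le> 1 + x ^ 2" if "x > 0" for x :: real
  proof (cases "x \<le> 1")
    case True
    then have "x powr (3 / 2) \<le> 1 powr (3 / 2)" using that by (intro powr_mono2) auto
    then show ?thesis using that by (smt (verit) powr_one_eq_one zero_le_power2)
  next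
    case False
    then have "x powr (3 / 2) \<le> x powr 2" by (intro powr_mono) auto
    then show ?thesis using that by simp
  qed
  have bd: "f t \<le> 1 + 2 * (4 / y\<^sup>2) ^ 2" "0 \<le> f t" "f t \<le> t powr (- 3 / 2)" if "t > 0" for t
  proof -
    define u where "u = y\<^sup>2 / (4 * t)"
    have u: "u > 0" using that assms by (simp add: u_def)
    have e1: "exp (- u) \<le> 1" using u by simp
    have "u\<^sup>2 / 2 \<le> exp u" using exp_lower_Taylor_quadratic[of u] u by linarith
    then have e2: "exp (- u) * u\<^sup>2 \<le> 2" by (simp add: exp_minus field_simps)
    have w: "1 / t powr (3 / 2) \<le> 1 + (4 / y\<^sup>2)\<^sup>2 * u\<^sup>2"
    proof -
      have "1 / t powr (3 / 2) = (1 / t) powr (3 / 2)" using that by (simp add: powr_divide)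
      also have "\<dots> \<le> 1 + (1 / t)\<^sup>2" using that by (intro sq) auto
      also have "1 / t = 4 / y\<^sup>2 * u" using that assms by (simp add: u_def)
      finally show ?thesis by (simp only: power_mult_distrib)
    qed
    have h: "0 \<le> heat_kernel t j" "heat_kernel t j \<le> 1"
      using heat_kernel_bounds[of t j] that by auto
    have f: "f t = exp (- u) / t powr (3 / 2) * heat_kernel t j" by (simp add: f_def u_def)
    show "0 \<le> f t" unfolding f using h by simp
    have f1: "f t \<le> exp (- u) / t powr (3 / 2)" unfolding f using h by (intro mult_left_le) auto
    also have "\<dots> \<le> 1 / t powr (3 / 2)" using e1 by (intro divide_right_mono) auto
    also have "\<dots> = t powr (- 3 / 2)" by (simp add: powr_minus_divide)
    finally show "f t \<le> t powr (- 3 / 2)" .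
    have "exp (- u) * (1 / t powr (3 / 2)) \<le> exp (- u) * (1 + (4 / y\<^sup>2)\<^sup>2 * u\<^sup>2)"
      by (intro mult_left_mono w) auto
    also have "\<dots> = exp (- u) + (4 / y\<^sup>2)\<^sup>2 * (exp (- u) * u\<^sup>2)" by (simp add: algebra_simps)
    also have "\<dots> \<le> 1 + (4 / y\<^sup>2)\<^sup>2 * 2" by (intro add_mono e1 mult_left_mono e2) auto
    finally show "f t \<le> 1 + 2 * (4 / y\<^sup>2) ^ 2" using f1 by simp
  qed
  have "set_integrable lborel {0<..1} f"
    unfolding set_integrable_def
  proof (rule Bochner_Integration.integrable_bound)
    show "integrable lborel (\<lambda>t::real. indicator {0<..1} t * (1 + 2 * (4 / y\<^sup>2) ^ 2))"
      by (intro integrable_mult_left integrable_real_indicator) auto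
    show "AE t in lborel. norm (indicator {0<..1} t *\<^sub>R f t)
            \<le> norm (indicator {0<..1} t * (1 + 2 * (4 / y\<^sup>2) ^ 2))"
      using bd(1,2) by (intro AE_I2) (simp add: indicator_def)
  qed measurable
  moreover have "set_integrable lborel {1..} f"
  proof -
    have "((\<lambda>x. x powr (- 3 / 2)) has_integral - (1 powr (- 3 / 2 + 1)) / (- 3 / 2 + 1)) {1::real..}"
      by (rule has_integral_powr_to_inf) auto
    then have "(\<lambda>x. x powr (- 3 / 2)) integrable_on {1::real..}" by blast
    then have "(\<lambda>x. x powr (- 3 / 2)) absolutely_integrable_on {1::real..}"
      by (intro nonnegative_absolutely_integrable_1) auto
    then have "set_integrable lborel {1..} (\<lambda>x::real. x powr (- 3 / 2))"
      unfolding set_integrable_def by (subst (asm) integrable_completion) auto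
    then show ?thesis
      unfolding set_integrable_def
      by (rule Bochner_Integration.integrable_bound)
         (use bd(2,3) in \<open>auto simp: indicator_def\<close>)
  qed
  ultimately have "set_integrable lborel ({0<..1} \<union> {1..}) f"
    by (intro set_integrable_Un) auto
  also have "{0<..1} \<union> {1..} = {0::real<..}" by auto
  finally show ?thesis unfolding f_def .
qed

end

theory Submission
  imports Defs
begin

text \<open>The Poisson kernel is a mixture of heat kernels over time. With \<open>z = y\<^sup>2 / 4\<close> the mixing density is
\<open>y / (2 sqrt pi) * t powr (- 3 / 2) * exp (- z / t)\<close>, and both estimates are obtained by bringing the
operator inside the mixture and then using Minkowski's inequality: the \<open>\<ell>\<^sup>1\<close> norm of a mixture is
at most the mixture of the \<open>\<ell>\<^sup>1\<close> norms. The powers of \<open>y\<close> all come from one scaling identity: the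
integral of \<open>t powr (- a) * exp (- z / t)\<close> over \<open>t > 0\<close> is a constant multiple of \<open>z powr (1 - a)\<close>
(\<open>integral_stable_weight\<close>).

For the derivatives in \<open>y\<close>, the operator acts on the mixing density only, and \<open>\<Sum>j. G(t,j) = 1\<close>.
Differentiating in \<open>z\<close> replaces the exponent \<open>a\<close> by \<open>a + 1\<close> and changes the sign, so every \<open>m\<close>-th
derivative is a linear combination of terms \<open>y powi (2 b + 1 - m)\<close> times the mixture with exponent
\<open>3 / 2 + b\<close>. Each such term has \<open>\<ell>\<^sup>1\<close> norm of order \<open>y powi (- m)\<close>; this class of functions is
\<open>poisson_like\<close>. Differentiation under the integral needs no limit theorem: since \<open>exp (- z / t)\<close> is
convex and its second derivative in \<open>z\<close> decreases, the error of the first-order expansion is at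
most \<open>(z' - z)\<^sup>2\<close> times a convergent integral of the same kind.

For the differences in \<open>j\<close>, the operator acts on the heat kernel only, and one needs that the \<open>l\<close>-th
difference of \<open>G(t, \<cdot>)\<close> has \<open>\<ell>\<^sup>1\<close> norm at most \<open>c * t powr (- l / 2)\<close>; the extra power of \<open>t\<close>
turns into the factor \<open>y powi (- l)\<close> after mixing. The point is that \<open>G(t, \<cdot>)\<close> is the law of the
difference of two independent Poisson variables of mean \<open>t\<close>, that is, the convolution of the Poisson
distribution \<open>q\<^sub>t\<close> with its reflection. As differences commute with convolution, Young's
inequality reduces the claim to \<open>q\<^sub>t\<close>. One difference is, up to sign and translation,
\<open>q\<^sub>t(i) - q\<^sub>t(i - 1) = q\<^sub>t(i) (1 - i / t)\<close>, and the mean of \<open>\<bar>1 - i / t\<bar>\<close> is at most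
\<open>1 / sqrt t\<close> because the variance of \<open>i / t\<close> is \<open>1 / t\<close>. For more differences, write
\<open>q\<^sub>t\<close> as the convolution of \<open>q\<^bsub>t/2\<^esub>\<close> with itself, let one difference act on one factor and the
remaining ones on the other, and induct.\<close>

section \<open>Bounds on \<open>\<ell>\<^sup>1\<close> norms\<close>

text \<open>A bound on an \<open>\<ell>\<^sup>1\<close> norm in terms of finite partial sums states summability and the size of the sum
at once, and it lets sums be exchanged with integrals without any convergence argument.\<close>

definition l1_le :: "('a \<Rightarrow> real) \<Rightarrow> real \<Rightarrow> bool" where
  "l1_le f B \<longleftrightarrow> (\<forall>F. finite F \<longrightarrow> (\<Sum>x\<in>F. \<bar>f x\<bar>) \<le> B)"

lemma l1_leI: "(\<And>F. finite F \<Longrightarrow> (\<Sum>x\<in>F. \<bar>f x\<bar>) \<le> B) \<Longrightarrow> l1_le f B"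
  by (simp add: l1_le_def)

lemma l1_leD: "l1_le f B \<Longrightarrow> finite F \<Longrightarrow> (\<Sum>x\<in>F. \<bar>f x\<bar>) \<le> B"
  by (simp add: l1_le_def)

lemma l1_le_nonneg: "l1_le f B \<Longrightarrow> 0 \<le> B"
  using l1_leD[of f B "{}"] by simp

lemma l1_le_pointwise: "l1_le f B \<Longrightarrow> \<bar>f x\<bar> \<le> B"
  using l1_leD[of f B "{x}"] by simp

lemma l1_le_mono: "l1_le f A \<Longrightarrow> A \<le> B \<Longrightarrow> l1_le f B"
  by (meson l1_le_def order_trans)

lemma l1_le_abs_mono: "l1_le g B \<Longrightarrow> (\<And>x. \<bar>f x\<bar> \<le> \<bar>g x\<bar>) \<Longrightarrow> l1_le f B"
  using order_trans[OF sum_mono[of _ "\<lambda>x. \<bar>f x\<bar>" "\<lambda>x. \<bar>g x\<bar>"]] by (simp add: l1_le_def)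

lemma l1_le_summable_on: "l1_le f B \<Longrightarrow> (\<lambda>x. \<bar>f x\<bar>) summable_on UNIV"
  by (rule nonneg_bdd_above_summable_on) (auto simp: l1_le_def bdd_above_def)

lemma l1_le_summable_on': "l1_le f B \<Longrightarrow> f summable_on UNIV"
  using l1_le_summable_on[of f B] abs_summable_summable[of f UNIV] by simp

lemma l1_le_infsum: "l1_le f B \<Longrightarrow> (\<Sum>\<^sub>\<infinity>x. \<bar>f x\<bar>) \<le> B"
  by (rule infsum_le_finite_sums[OF l1_le_summable_on]) (auto simp: l1_le_def)

lemma abs_infsum_le: "l1_le f B \<Longrightarrow> \<bar>\<Sum>\<^sub>\<infinity>x. f x\<bar> \<le> (\<Sum>\<^sub>\<infinity>x. \<bar>f x\<bar>)"
  using norm_infsum_bound[of f UNIV] l1_le_summable_on[of f B] by simp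

lemma l1_le_add: "l1_le f A \<Longrightarrow> l1_le g B \<Longrightarrow> l1_le (\<lambda>x. f x + g x) (A + B)"
proof (rule l1_leI)
  fix F :: "'a set"
  assume "l1_le f A" "l1_le g B" "finite F"
  then have "(\<Sum>x\<in>F. \<bar>f x\<bar>) + (\<Sum>x\<in>F. \<bar>g x\<bar>) \<le> A + B"
    by (intro add_mono l1_leD)
  moreover have "(\<Sum>x\<in>F. \<bar>f x + g x\<bar>) \<le> (\<Sum>x\<in>F. \<bar>f x\<bar>) + (\<Sum>x\<in>F. \<bar>g x\<bar>)"
    by (simp add: sum.distrib[symmetric] sum_mono)
  ultimately show "(\<Sum>x\<in>F. \<bar>f x + g x\<bar>) \<le> A + B" by linarith
qed

lemma l1_le_cmult: "l1_le f B \<Longrightarrow> l1_le (\<lambda>x. c * f x) (\<bar>c\<bar> * B)"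
  by (simp add: l1_le_def abs_mult sum_distrib_left[symmetric] mult_left_mono)

lemma l1_le_reindex: "l1_le f B \<Longrightarrow> inj g \<Longrightarrow> l1_le (\<lambda>x. f (g x)) B"
proof (rule l1_leI)
  fix F :: "'b set"
  assume "l1_le f B" "inj g" "finite F"
  then have "(\<Sum>x\<in>F. \<bar>f (g x)\<bar>) = (\<Sum>y\<in>g ` F. \<bar>f y\<bar>)"
    by (subst sum.reindex) (auto intro: inj_on_subset)
  then show "(\<Sum>x\<in>F. \<bar>f (g x)\<bar>) \<le> B"
    using l1_leD[of f B "g ` F"] \<open>l1_le f B\<close> \<open>finite F\<close> by simp
qed

text \<open>Minkowski's integral inequality. Only finitely many indices are involved at a time, so linearity
and monotonicity of the integral suffice.\<close>

lemma l1_le_integral: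
  assumes int: "\<And>j. integrable N (\<lambda>t. f t j)" "integrable N B"
    and le: "\<And>t. l1_le (f t) (B t)"
  shows "l1_le (\<lambda>j. \<integral>t. f t j \<partial>N) (\<integral>t. B t \<partial>N)"
proof (rule l1_leI)
  fix F :: "'a set" assume "finite F"
  have "(\<Sum>j\<in>F. \<bar>\<integral>t. f t j \<partial>N\<bar>) \<le> (\<Sum>j\<in>F. \<integral>t. \<bar>f t j\<bar> \<partial>N)"
    by (intro sum_mono integral_abs_bound)
  also have "\<dots> = (\<integral>t. (\<Sum>j\<in>F. \<bar>f t j\<bar>) \<partial>N)"
    by (rule Bochner_Integration.integral_sum[symmetric]) (use int in auto)
  also have "\<dots> \<le> (\<integral>t. B t \<partial>N)"
    using int le \<open>finite F\<close>
    by (intro integral_mono Bochner_Integration.integrable_sum) (auto intro: l1_leD)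
  finally show "(\<Sum>j\<in>F. \<bar>\<integral>t. f t j \<partial>N\<bar>) \<le> (\<integral>t. B t \<partial>N)" .
qed

section \<open>Convolution on the integers\<close>

definition conv :: "(int \<Rightarrow> real) \<Rightarrow> (int \<Rightarrow> real) \<Rightarrow> int \<Rightarrow> real" where
  "conv f g n = (\<Sum>\<^sub>\<infinity>i. f i * g (n - i))"

lemma l1_le_conv_summand:
  assumes "l1_le f A" "l1_le g B"
  shows "l1_le (\<lambda>i. f i * g (n - i)) (A * B)"
proof (rule l1_le_abs_mono)
  show "l1_le (\<lambda>i. B * f i) (A * B)"
    using l1_le_cmult[OF assms(1), of B] l1_le_nonneg[OF assms(2)] by (simp add: mult.commute)
  show "\<bar>f i * g (n - i)\<bar> \<le> \<bar>B * f i\<bar>" for i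
    using mult_left_mono[OF l1_le_pointwise[OF assms(2), of "n - i"], of "\<bar>f i\<bar>"]
      l1_le_nonneg[OF assms(2)]
    by (simp add: abs_mult mult.commute)
qed

text \<open>Young's inequality: sum over \<open>n\<close> first, where each translate of \<open>g\<close> contributes at most \<open>B\<close>, and
then over \<open>i\<close>.\<close>

lemma l1_le_conv:
  assumes "l1_le f A" "l1_le g B"
  shows "l1_le (conv f g) (A * B)"
proof (rule l1_leI)
  fix F :: "int set" assume F: "finite F"
  note s = l1_le_conv_summand[OF assms]
  \<comment> \<open>The sum over \<open>n\<close> is finite, so it may be pulled out of the unordered sum over \<open>i\<close>.\<close>
  have exch: "((\<lambda>i. \<Sum>n\<in>F. \<bar>f i * g (n - i)\<bar>) has_sum (\<Sum>n\<in>F. \<Sum>\<^sub>\<infinity>i. \<bar>f i * g (n - i)\<bar>)) UNIV"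
    using F
  proof induction
    case (insert n F)
    then show ?case
      by (simp add: has_sum_add has_sum_infsum[OF l1_le_summable_on[OF s]])
  qed simp
  have "(\<Sum>n\<in>F. \<bar>conv f g n\<bar>) \<le> (\<Sum>n\<in>F. \<Sum>\<^sub>\<infinity>i. \<bar>f i * g (n - i)\<bar>)"
    unfolding conv_def by (intro sum_mono abs_infsum_le[OF s])
  also have "\<dots> \<le> A * B"
  proof (rule has_sum_le_finite_sums[OF exch])
    fix E :: "int set" assume E: "finite E"
    have "(\<Sum>i\<in>E. \<Sum>n\<in>F. \<bar>f i * g (n - i)\<bar>) \<le> (\<Sum>i\<in>E. \<bar>f i\<bar> * B)"
    proof (rule sum_mono)
      fix i
      have "(\<Sum>n\<in>F. \<bar>f i * g (n - i)\<bar>) = \<bar>f i\<bar> * (\<Sum>n\<in>F. \<bar>g (n - i)\<bar>)"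
        by (simp add: abs_mult sum_distrib_left)
      also have "\<dots> \<le> \<bar>f i\<bar> * B"
        using F by (intro mult_left_mono l1_leD[OF l1_le_reindex[OF assms(2)]]) (auto simp: inj_def)
      finally show "(\<Sum>n\<in>F. \<bar>f i * g (n - i)\<bar>) \<le> \<bar>f i\<bar> * B" .
    qed
    also have "\<dots> \<le> A * B"
      using l1_leD[OF assms(1) E] l1_le_nonneg[OF assms(2)]
      by (simp add: sum_distrib_right[symmetric] mult_right_mono)
    finally show "(\<Sum>i\<in>E. \<Sum>n\<in>F. \<bar>f i * g (n - i)\<bar>) \<le> A * B" .
  qed
  finally show "(\<Sum>n\<in>F. \<bar>conv f g n\<bar>) \<le> A * B" .
qed

lemma conv_commute: "conv f g = conv g f"
proof
  fix n
  have "bij_betw (\<lambda>i. n - i) UNIV (UNIV :: int set)"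
    by (rule bij_betwI[where g = "\<lambda>i. n - i"]) auto
  from infsum_reindex_bij_betw[OF this, of "\<lambda>i. f i * g (n - i)"]
  show "conv f g n = conv g f n"
    by (simp add: conv_def mult.commute)
qed

lemma l1_le_delta_right: "l1_le f B \<Longrightarrow> l1_le (delta_right f) (2 * B)"
  unfolding delta_right_def
  using l1_le_add[of f B "\<lambda>j. (- 1) * f (j + 1)" B]
    l1_le_cmult[OF l1_le_reindex[of f B "\<lambda>j. j + 1"], of "- 1"]
  by (simp add: inj_def)

lemma l1_le_delta_right_funpow: "l1_le f B \<Longrightarrow> l1_le ((delta_right ^^ l) f) (2 ^ l * B)"
proof (induction l)
  case (Suc l)
  then show ?case using l1_le_delta_right[of "(delta_right ^^ l) f" "2 ^ l * B"] by (simp add: ac_simps)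
qed simp

lemma delta_right_conv:
  assumes "l1_le f A" "l1_le g B"
  shows "delta_right (conv f g) = conv f (delta_right g)"
proof
  fix n
  note s = l1_le_summable_on'[OF l1_le_conv_summand[OF assms]]
  have "conv f (delta_right g) n = (\<Sum>\<^sub>\<infinity>i. f i * g (n - i) + - (f i * g (n + 1 - i)))"
    by (simp add: conv_def delta_right_def algebra_simps)
  also have "\<dots> = conv f g n + - conv f g (n + 1)"
    unfolding conv_def infsum_uminus[symmetric]
    by (intro infsum_add s summable_on_uminus[THEN iffD2])
  finally show "delta_right (conv f g) n = conv f (delta_right g) n"
    by (simp add: delta_right_def)
qed

text \<open>Convolution is translation invariant, so all differences may be put on one factor; by
\<open>conv_commute\<close>, either factor can be chosen.\<close>

lemma delta_right_funpow_conv: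
  assumes "l1_le f A" "l1_le g B"
  shows "(delta_right ^^ l) (conv f g) = conv f ((delta_right ^^ l) g)"
proof (induction l)
  case (Suc l)
  then show ?case
    using delta_right_conv[OF assms(1) l1_le_delta_right_funpow[OF assms(2), of l]] by simp
qed simp

section \<open>The Poisson distribution\<close>

lemma l1_le_has_sum: "(f has_sum S) UNIV \<Longrightarrow> (\<And>x. 0 \<le> f x) \<Longrightarrow> l1_le f S" for f :: "'a \<Rightarrow> real"
  by (rule l1_leI) (auto intro: finite_sum_le_has_sum)

text \<open>Passes from a series indexed by \<open>nat\<close>, as in the definition of the Bessel function, to an unordered
sum; \<open>h\<close> enumerates an index set outside which all terms vanish.\<close>

lemma has_sum_along_injection:
  fixes f :: "'a \<Rightarrow> real" and h :: "nat \<Rightarrow> 'a"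
  assumes "(\<lambda>k. f (h k)) sums S" "inj h" "\<And>x. 0 \<le> f x" "\<And>x. x \<notin> range h \<Longrightarrow> f x = 0"
  shows "(f has_sum S) UNIV"
proof -
  have "((f \<circ> h) has_sum S) UNIV"
    using assms by (intro sums_nonneg_imp_has_sum) (auto simp: o_def)
  then have "(f has_sum S) (range h)"
    using assms(2) by (simp add: has_sum_reindex)
  then show ?thesis
    using assms(4) by (subst has_sum_cong_neutral[where T = "range h" and g = f]) auto
qed

text \<open>The Poisson distribution of mean \<open>t\<close>, extended by zero to the negative integers so that it can be
convolved and differenced on the whole of \<open>\<int>\<close>.\<close>

definition poisson_weight :: "real \<Rightarrow> int \<Rightarrow> real" where
  "poisson_weight t i = (if i < 0 then 0 else exp (- t) * (t ^ nat i / fact (nat i)))"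

lemma poisson_weight_neg [simp]: "i < 0 \<Longrightarrow> poisson_weight t i = 0"
  and poisson_weight_int [simp]: "poisson_weight t (int k) = exp (- t) * (t ^ k / fact k)"
  by (simp_all add: poisson_weight_def)

lemma poisson_weight_nonneg [simp]: "0 \<le> t \<Longrightarrow> 0 \<le> poisson_weight t i"
  by (simp add: poisson_weight_def)

lemma has_sum_nonneg_int:
  fixes f :: "int \<Rightarrow> real"
  assumes "(\<lambda>k. f (int k)) sums S" "\<And>i. 0 \<le> f i" "\<And>i. i < 0 \<Longrightarrow> f i = 0"
  shows "(f has_sum S) UNIV"
proof (rule has_sum_along_injection[of f int])
  fix i :: int
  assume "i \<notin> range int"
  then have "i < 0" by (metis nonneg_int_cases not_less rangeI)
  then show "f i = 0" by (rule assms)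
qed (use assms in auto)

lemma exp_series_sums: "(\<lambda>k. t ^ k / fact k) sums exp t" for t :: real
  using exp_converges[of t] by (simp add: divide_inverse_commute)

lemma l1_le_poisson_weight:
  assumes "0 \<le> t" shows "l1_le (poisson_weight t) 1"
proof (intro l1_le_has_sum has_sum_nonneg_int)
  show "(\<lambda>k. poisson_weight t (int k)) sums 1"
    using sums_mult[OF exp_series_sums[of t], of "exp (- t)"] by (simp add: exp_minus)
qed (use assms in auto)

text \<open>The variance of a Poisson variable \<open>i\<close> of mean \<open>t\<close> is \<open>t\<close>, hence that of \<open>i / t\<close> is \<open>1 / t\<close>.\<close>

lemma poisson_weight_variance:
  assumes "0 < t"
  shows "l1_le (\<lambda>i. poisson_weight t i * (1 - i / t)\<^sup>2) (1 / t)"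
proof (intro l1_le_has_sum has_sum_nonneg_int)
  \<comment> \<open>The first two moments, up to the factor \<open>exp (- t)\<close>: the factor \<open>k\<close> cancels against \<open>fact k\<close> and shifts the exponential series by one.\<close>
  let ?e = "\<lambda>k. t ^ k / fact k :: real"
  have e1: "(\<lambda>k. real k * ?e k) sums (t * exp t)"
  proof -
    have "(\<lambda>k. real (Suc k) * ?e (Suc k)) sums (t * exp t)"
      using sums_mult[OF exp_series_sums[of t], of t] by (simp add: field_simps del: of_nat_Suc)
    then show ?thesis by (subst (asm) sums_Suc_iff) simp
  qed
  have e2: "(\<lambda>k. real k * (real k * ?e k)) sums (t * (t * exp t + exp t))"
  proof -
    have "real (Suc k) * (real (Suc k) * ?e (Suc k)) = t * (real k * ?e k + ?e k)" for k
    proof -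
      have "real (Suc k) * ?e (Suc k) = t * ?e k" by (simp add: field_simps del: of_nat_Suc)
      moreover have "real (Suc k) * (t * x) = t * (real k * x + x)" for x
        by (simp add: algebra_simps)
      ultimately show ?thesis by (simp only:)
    qed
    then have "(\<lambda>k. real (Suc k) * (real (Suc k) * ?e (Suc k))) sums (t * (t * exp t + exp t))"
      using sums_mult[OF sums_add[OF e1 exp_series_sums[of t]], of t] by simp
    then show ?thesis by (subst (asm) sums_Suc_iff) simp
  qed
  have "(\<lambda>k. exp (- t) * (?e k - 2 / t * (real k * ?e k) + 1 / t\<^sup>2 * (real k * (real k * ?e k)))) sums
      (exp (- t) * (exp t - 2 / t * (t * exp t) + 1 / t\<^sup>2 * (t * (t * exp t + exp t))))"
    by (intro sums_mult sums_add sums_diff exp_series_sums e1 e2)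
  also have "(\<lambda>k. exp (- t) * (?e k - 2 / t * (real k * ?e k) + 1 / t\<^sup>2 * (real k * (real k * ?e k))))
      = (\<lambda>k. poisson_weight t (int k) * (1 - int k / t)\<^sup>2)"
  proof
    fix k
    have "(1 - real k / t)\<^sup>2 = 1 - 2 / t * real k + 1 / t\<^sup>2 * (real k * real k)"
      by (simp add: power2_eq_square algebra_simps)
    note square = this
    show "exp (- t) * (?e k - 2 / t * (real k * ?e k) + 1 / t\<^sup>2 * (real k * (real k * ?e k)))
        = poisson_weight t (int k) * (1 - int k / t)\<^sup>2"
      unfolding poisson_weight_int of_int_of_nat_eq square by (simp add: algebra_simps)
  qed
  also have "exp (- t) * (exp t - 2 / t * (t * exp t) + 1 / t\<^sup>2 * (t * (t * exp t + exp t)))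
      = (exp (- t) * exp t) * (1 / t)"
    using assms by (simp add: field_simps power2_eq_square)
  also have "\<dots> = 1 / t" by (simp add: exp_minus)
  finally show "(\<lambda>k. poisson_weight t (int k) * (1 - int k / t)\<^sup>2) sums (1 / t)" .
qed (use assms in auto)

text \<open>By the recurrence \<open>t * q\<^sub>t(i - 1) = i * q\<^sub>t(i)\<close>, the difference is \<open>q\<^sub>t\<close> times the deviation
\<open>1 - i / t\<close>. The mean absolute deviation is bounded by the standard deviation \<open>1 / sqrt t\<close>;
the inequality \<open>\<bar>x\<bar> \<le> 1 / (2 r) + r x\<^sup>2 / 2\<close> with \<open>r = sqrt t\<close> serves as a termwise form of
Cauchy--Schwarz.\<close>

lemma l1_le_delta_right_poisson_weight:
  assumes t: "0 < t"
  shows "l1_le (delta_right (poisson_weight t)) (1 / sqrt t)"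
proof -
  define r where "r = sqrt t"
  have r: "r > 0" "r * r = t" using t by (auto simp: r_def)
  have recurrence: "poisson_weight t (i - 1) = poisson_weight t i * (i / t)" for i
  proof (cases "i \<le> 0")
    case False
    then obtain k where "i = int (Suc k)" by (metis not_le pos_int_cases Suc_pred')
    moreover have "int (Suc k) - 1 = int k" by simp
    ultimately show ?thesis
      using t by (simp only: poisson_weight_int) (simp add: field_simps del: of_nat_Suc)
  qed (auto simp: poisson_weight_def)
  have pt: "\<bar>delta_right (poisson_weight t) (i - 1)\<bar>
      \<le> \<bar>1 / (2 * r) * poisson_weight t i + r / 2 * (poisson_weight t i * (1 - i / t)\<^sup>2)\<bar>" for i
  proof -
    let ?x = "1 - i / t"
    have "0 \<le> (\<bar>?x\<bar> * r - 1)\<^sup>2 / (2 * r)" using r by simp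
    also have "\<dots> = 1 / (2 * r) + r / 2 * ?x\<^sup>2 - \<bar>?x\<bar>"
      using r(1) by (simp add: power2_eq_square field_simps)
    finally have "\<bar>?x\<bar> \<le> 1 / (2 * r) + r / 2 * ?x\<^sup>2" by simp
    then have "poisson_weight t i * \<bar>?x\<bar> \<le> poisson_weight t i * (1 / (2 * r) + r / 2 * ?x\<^sup>2)"
      using t by (intro mult_left_mono) auto
    moreover have "delta_right (poisson_weight t) (i - 1) = - (poisson_weight t i * ?x)"
      by (simp add: delta_right_def recurrence algebra_simps)
    ultimately have "\<bar>delta_right (poisson_weight t) (i - 1)\<bar>
        \<le> poisson_weight t i * (1 / (2 * r) + r / 2 * ?x\<^sup>2)"
      using t by (simp only: abs_mult abs_minus_cancel) simp
    also have "\<dots> = 1 / (2 * r) * poisson_weight t i + r / 2 * (poisson_weight t i * ?x\<^sup>2)"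
      by (simp add: algebra_simps)
    finally show ?thesis by linarith
  qed
  have "l1_le (\<lambda>i. 1 / (2 * r) * poisson_weight t i + r / 2 * (poisson_weight t i * (1 - i / t)\<^sup>2))
      (\<bar>1 / (2 * r)\<bar> * 1 + \<bar>r / 2\<bar> * (1 / t))"
    using t by (intro l1_le_add l1_le_cmult l1_le_poisson_weight poisson_weight_variance) auto
  also have "\<bar>1 / (2 * r)\<bar> * 1 + \<bar>r / 2\<bar> * (1 / t) = 1 / r"
    using r(1) unfolding r(2)[symmetric] by (simp add: field_simps)
  finally have "l1_le (\<lambda>i. delta_right (poisson_weight t) (i - 1)) (1 / r)"
    by (rule l1_le_abs_mono) (rule pt)
  from l1_le_reindex[OF this, of "\<lambda>i. i + 1"] show ?thesis
    by (simp add: r_def inj_def)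
qed

text \<open>The semigroup law. At a natural number it is the binomial theorem, in the form of the addition
theorem for the terms of the exponential series.\<close>

lemma conv_poisson_weight: "conv (poisson_weight s) (poisson_weight t) = poisson_weight (s + t)"
proof
  fix n
  show "conv (poisson_weight s) (poisson_weight t) n = poisson_weight (s + t) n"
  proof (cases "n < 0")
    case True
    then have "poisson_weight s i * poisson_weight t (n - i) = 0" for i
      by (simp add: poisson_weight_def)
    then have "conv (poisson_weight s) (poisson_weight t) n = 0"
      unfolding conv_def by (intro infsum_0)
    then show ?thesis using True by simp
  next
    case False
    then obtain N where n: "n = int N" by (metis nonneg_int_cases not_less)
    have "conv (poisson_weight s) (poisson_weight t) n
        = (\<Sum>\<^sub>\<infinity>i\<in>int ` {..N}. poisson_weight s i * poisson_weight t (n - i))"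
      unfolding conv_def
    proof (rule infsum_cong_neutral)
      fix i assume "i \<in> UNIV - int ` {..N}"
      then have "i < 0 \<or> n - i < 0"
        unfolding n by (metis DiffD2 atMost_iff diff_less_0_iff_less image_eqI nonneg_int_cases not_less of_nat_le_iff)
      then show "poisson_weight s i * poisson_weight t (n - i) = 0" by auto
    qed auto
    also have "\<dots> = (\<Sum>i\<le>N. poisson_weight s (int i) * poisson_weight t (n - int i))"
      by (simp add: sum.reindex)
    also have "\<dots> = (\<Sum>i\<le>N. exp (- (s + t)) * ((s ^ i / fact i) * (t ^ (N - i) / fact (N - i))))"
    proof (rule sum.cong)
      fix i assume "i \<in> {..N}"
      then have "n - int i = int (N - i)" by (simp add: n)
      then show "poisson_weight s (int i) * poisson_weight t (n - int i)
          = exp (- (s + t)) * ((s ^ i / fact i) * (t ^ (N - i) / fact (N - i)))"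
        by (simp only: poisson_weight_int) (simp add: exp_add exp_diff exp_minus field_simps)
    qed simp
    also have "\<dots> = exp (- (s + t)) * ((s + t) ^ N / fact N)"
      using exp_series_add_commuting[of s t N]
      by (simp add: sum_distrib_left[symmetric] divide_inverse_commute)
    finally show ?thesis by (simp add: n)
  qed
qed

text \<open>Each difference gains a factor \<open>t powr (- 1 / 2)\<close>. In the induction step half of the time is spent
on the new difference and the other half on the old ones, which costs only a constant.\<close>

lemma l1_le_delta_right_funpow_poisson_weight:
  "\<exists>c\<ge>0. \<forall>t>0. l1_le ((delta_right ^^ l) (poisson_weight t)) (c * t powr (- real l / 2))"
proof (induction l)
  case 0
  then show ?case
    by (intro exI[of _ 1]) (auto simp: l1_le_poisson_weight)
next
  case (Suc l)
  then obtain c where c: "c \<ge> 0"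
    "\<And>t. t > 0 \<Longrightarrow> l1_le ((delta_right ^^ l) (poisson_weight t)) (c * t powr (- real l / 2))"
    by blast
  have "l1_le ((delta_right ^^ Suc l) (poisson_weight t))
      (2 powr (real (Suc l) / 2) * c * t powr (- real (Suc l) / 2))" if t: "t > 0" for t
  proof -
    define s where "s = t / 2"
    have s: "s > 0" "0 \<le> s" "t = s + s" using t by (auto simp: s_def)
    note q = l1_le_poisson_weight[OF s(2)]
    have "(delta_right ^^ Suc l) (poisson_weight t)
        = (delta_right ^^ l) (delta_right (conv (poisson_weight s) (poisson_weight s)))"
      by (simp only: funpow_Suc_right o_apply s(3) conv_poisson_weight)
    also have "\<dots> = (delta_right ^^ l) (conv (delta_right (poisson_weight s)) (poisson_weight s))"
      by (simp only: delta_right_conv[OF q q] conv_commute)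
    also have "\<dots> = conv (delta_right (poisson_weight s)) ((delta_right ^^ l) (poisson_weight s))"
      by (rule delta_right_funpow_conv[OF l1_le_delta_right_poisson_weight[OF s(1)] q])
    finally have "l1_le ((delta_right ^^ Suc l) (poisson_weight t))
        (1 / sqrt s * (c * s powr (- real l / 2)))"
      using l1_le_conv[OF l1_le_delta_right_poisson_weight[OF s(1)] c(2)[OF s(1)]] by simp
    also have "1 / sqrt s * (c * s powr (- real l / 2)) = c * (s powr (- 1 / 2) * s powr (- real l / 2))"
      using s(1) by (simp add: powr_minus_divide powr_half_sqrt)
    also have "s powr (- 1 / 2) * s powr (- real l / 2) = s powr (- real (Suc l) / 2)"
      by (simp add: powr_add[symmetric] field_simps)
    also have "\<dots> = 2 powr (real (Suc l) / 2) * t powr (- real (Suc l) / 2)"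
    proof -
      have "(t / 2) powr (- p) = 2 powr p * t powr (- p)" for p
        using t by (simp add: powr_divide powr_minus field_simps)
      from this[of "real (Suc l) / 2"] show ?thesis by (simp only: s_def minus_divide_left)
    qed
    finally show ?thesis by (simp add: ac_simps)
  qed
  then show ?case
    using c(1) by (intro exI[of _ "2 powr (real (Suc l) / 2) * c"]) auto
qed

section \<open>Differences of the heat kernel\<close>

text \<open>The Bessel series of \<open>exp (- 2 t) * I\<^sub>n(2 t)\<close> lists the probabilities of all pairs of values, of two
independent Poisson variables of mean \<open>t\<close>, whose difference is \<open>n\<close>.\<close>

lemma heat_kernel_eq_conv:
  assumes t: "0 \<le> t"
  shows "heat_kernel t = conv (\<lambda>i. poisson_weight t (- i)) (poisson_weight t)"
proof
  fix n :: int
  define k where "k = nat \<bar>n\<bar>"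
  \<comment> \<open>The summand of index \<open>i\<close> vanishes unless \<open>- i \<ge> 0\<close> and \<open>n - i \<ge> 0\<close>; \<open>h\<close> enumerates these \<open>i\<close> downwards.\<close>
  define h where "h m = - (int m + max 0 (- n))" for m
  let ?f = "\<lambda>i. poisson_weight t (- i) * poisson_weight t (n - i)"
  have "(?f has_sum heat_kernel t n) UNIV"
  proof (rule has_sum_along_injection[of ?f h])
    have "summable (\<lambda>m. t ^ m / fact m * (t ^ (m + k) / fact (m + k)))"
      using summable_bessel_I[of k "2 * t"] unfolding bessel_I_term .
    then have "(\<lambda>m. t ^ m / fact m * (t ^ (m + k) / fact (m + k))) sums bessel_I n (2 * t)"
      unfolding bessel_I_def k_def[symmetric] bessel_I_term by (rule summable_sums)
    from sums_mult[OF this, of "exp (- 2 * t)"]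
    have "(\<lambda>m. exp (- 2 * t) * (t ^ m / fact m * (t ^ (m + k) / fact (m + k)))) sums heat_kernel t n"
      by (simp add: heat_kernel_def)
    also have "(\<lambda>m. exp (- 2 * t) * (t ^ m / fact m * (t ^ (m + k) / fact (m + k)))) = (\<lambda>m. ?f (h m))"
    proof
      fix m
      have e: "exp (- 2 * t) = exp (- t) * exp (- t)" by (simp add: exp_add[symmetric])
      have "(- h m = int m \<and> n - h m = int (m + k)) \<or> (- h m = int (m + k) \<and> n - h m = int m)"
        by (auto simp: h_def k_def max_def)
      then show "exp (- 2 * t) * (t ^ m / fact m * (t ^ (m + k) / fact (m + k))) = ?f (h m)"
        unfolding e by (elim disjE conjE) (simp_all only: poisson_weight_int mult_ac)
    qed
    finally show "(\<lambda>m. ?f (h m)) sums heat_kernel t n" .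
    show "?f i = 0" if "i \<notin> range h" for i
    proof (rule ccontr)
      assume "?f i \<noteq> 0"
      then have "0 \<le> - i - max 0 (- n)" by (auto simp: poisson_weight_def split: if_splits)
      then have "i = h (nat (- i - max 0 (- n)))" by (simp add: h_def)
      with that show False by blast
    qed
  qed (use t in \<open>auto simp: inj_def h_def\<close>)
  then show "heat_kernel t n = conv (\<lambda>i. poisson_weight t (- i)) (poisson_weight t) n"
    unfolding conv_def by (rule infsumI[symmetric])
qed

lemma l1_le_poisson_weight_reflected:
  assumes "0 \<le> t" shows "l1_le (\<lambda>i. poisson_weight t (- i)) 1"
  using l1_le_reindex[OF l1_le_poisson_weight[OF assms], of uminus] by simp

lemma l1_le_heat_kernel: "0 \<le> t \<Longrightarrow> l1_le (heat_kernel t) 1"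
  using l1_le_conv[OF l1_le_poisson_weight_reflected l1_le_poisson_weight, of t t]
  by (simp add: heat_kernel_eq_conv)

lemma l1_le_delta_right_funpow_heat_kernel:
  "\<exists>c\<ge>0. \<forall>t>0. l1_le ((delta_right ^^ l) (heat_kernel t)) (c * t powr (- real l / 2))"
proof -
  obtain c where c: "c \<ge> 0"
    "\<And>t. t > 0 \<Longrightarrow> l1_le ((delta_right ^^ l) (poisson_weight t)) (c * t powr (- real l / 2))"
    using l1_le_delta_right_funpow_poisson_weight by blast
  have "l1_le ((delta_right ^^ l) (heat_kernel t)) (c * t powr (- real l / 2))" if "t > 0" for t
    using that l1_le_conv[OF l1_le_poisson_weight_reflected[of t] c(2)[OF that]]
      delta_right_funpow_conv[OF l1_le_poisson_weight_reflected[of t] l1_le_poisson_weight[of t]]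
    by (simp add: heat_kernel_eq_conv)
  with c(1) show ?thesis by blast
qed

section \<open>The mixing density\<close>

text \<open>For \<open>a = 3 / 2\<close> this is, up to normalisation, the density of the stable law of index \<open>1 / 2\<close>. The
exponent \<open>a\<close> is left free since derivatives in \<open>z\<close> and bounds \<open>t powr (- p)\<close> both shift it.\<close>

definition stable_weight :: "real \<Rightarrow> real \<Rightarrow> real \<Rightarrow> real" where
  "stable_weight a z t = indicator {0<..} t * (t powr (- a) * exp (- z / t))"

lemma borel_measurable_stable_weight [measurable]: "stable_weight a z \<in> borel_measurable borel"
  unfolding stable_weight_def by measurable

lemma stable_weight_nonneg [simp]: "0 \<le> stable_weight a z t"
  by (simp add: stable_weight_def)

lemma stable_weight_nonpos [simp]: "t \<le> 0 \<Longrightarrow> stable_weight a z t = 0"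
  by (simp add: stable_weight_def)

text \<open>Near zero, \<open>exp (- 1 / t)\<close> beats every power of \<open>1 / t\<close>, so that the weight is bounded there; near
infinity it is dominated by \<open>t powr (- a)\<close>.\<close>

lemma integrable_stable_weight_1:
  assumes "a > 1"
  shows "integrable lborel (stable_weight a 1)"
proof -
  define N where "N = nat \<lceil>a\<rceil>"
  have N: "a \<le> real N" unfolding N_def by linarith
  have small: "t powr (- a) * exp (- 1 / t) \<le> fact N" if "0 < t" "t < 1" for t
  proof -
    have "t powr (- a) = (1 / t) powr a"
      using that by (simp add: powr_divide powr_minus_divide)
    also have "\<dots> \<le> (1 / t) powr real N"
      using that N by (intro powr_mono) auto
    also have "\<dots> = (1 / t) ^ N"
      using that by (intro powr_realpow) auto
    also have "\<dots> \<le> fact N * exp (1 / t)"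
    proof -
      have "(1 / t) ^ N / fact N \<le> exp (1 / t)"
        using sum_le_suminf[of "\<lambda>i. (1 / t) ^ i / fact i" "{N}"] exp_series_sums[of "1 / t"] that
        by (auto simp: sums_iff)
      then show ?thesis by (simp add: pos_divide_le_eq mult.commute)
    qed
    finally have "t powr (- a) * exp (- 1 / t) \<le> fact N * exp (1 / t) * exp (- 1 / t)"
      by (intro mult_right_mono) auto
    also have "\<dots> = fact N" by (simp add: exp_minus)
    finally show ?thesis .
  qed
  have "((\<lambda>x. x powr (- a)) has_integral - (1 powr (- a + 1)) / (- a + 1)) {1::real..}"
    by (rule has_integral_powr_to_inf) (use assms in auto)
  then have "(\<lambda>x. x powr (- a)) integrable_on {1::real..}" by blast
  then have "(\<lambda>x. x powr (- a)) absolutely_integrable_on {1::real..}"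
    by (intro nonnegative_absolutely_integrable_1) auto
  then have tail: "integrable lborel (\<lambda>t::real. indicator {1..} t * t powr (- a))"
    unfolding set_integrable_def by (subst (asm) integrable_completion) auto
  show ?thesis
  proof (rule Bochner_Integration.integrable_bound)
    show "integrable lborel (\<lambda>t::real. indicator {0<..<1} t * fact N + indicator {1..} t * t powr (- a))"
      by (intro Bochner_Integration.integrable_add tail integrable_mult_left integrable_real_indicator) auto
    have "stable_weight a 1 t \<le> indicator {0<..<1} t * fact N + indicator {1..} t * t powr (- a)" for t
    proof -
      consider "t \<le> 0" | "0 < t" "t < 1" | "1 \<le> t" by linarith
      then show ?thesis
      proof cases
        case 3
        then have "t powr (- a) * exp (- 1 / t) \<le> t powr (- a) * 1"
          by (intro mult_left_mono) auto
        with 3 show ?thesis by (simp add: stable_weight_def)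
      qed (use small in \<open>auto simp: stable_weight_def\<close>)
    qed
    then show "AE t in lborel. norm (stable_weight a 1 t)
        \<le> norm (indicator {0<..<1} t * fact N + indicator {1..} t * t powr (- a))"
      by (intro AE_I2) (simp add: order_trans[OF _ abs_ge_self])
  qed simp
qed

text \<open>The substitution \<open>t = z * s\<close>; the argument is written in the form in which affine substitution in the
Lebesgue integral produces it.\<close>

lemma stable_weight_scale:
  "z > 0 \<Longrightarrow> stable_weight a z (0 + z * s) = z powr (- a) * stable_weight a 1 s"
  by (simp add: stable_weight_def indicator_def powr_mult zero_less_mult_iff)

lemma integrable_stable_weight:
  assumes "a > 1" "z > 0"
  shows "integrable lborel (stable_weight a z)"
  using integrable_stable_weight_1[OF assms(1)] assms(2)
    lborel_integrable_real_affine_iff[of z "stable_weight a z" 0]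
  by (simp only: stable_weight_scale) simp

lemma integral_stable_weight:
  assumes "z > 0"
  shows "(\<integral>t. stable_weight a z t \<partial>lborel) = z powr (1 - a) * (\<integral>t. stable_weight a 1 t \<partial>lborel)"
proof -
  have "(\<integral>t. stable_weight a z t \<partial>lborel) = z * (z powr (- a) * (\<integral>t. stable_weight a 1 t \<partial>lborel))"
    using assms lborel_integral_real_affine[of z "stable_weight a z" 0]
    by (simp only: stable_weight_scale) simp
  also have "z * (z powr (- a) * (\<integral>t. stable_weight a 1 t \<partial>lborel))
      = (z powr 1 * z powr (- a)) * (\<integral>t. stable_weight a 1 t \<partial>lborel)"
    using assms by simp
  finally show ?thesis by (simp only: powr_add[symmetric]) simp
qed

lemma integrable_stable_weight_mult:
  assumes "a > 1" "z > 0" and [measurable]: "g \<in> borel_measurable borel"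
    and "\<And>t. t > 0 \<Longrightarrow> \<bar>g t\<bar> \<le> B"
  shows "integrable lborel (\<lambda>t. stable_weight a z t * g t)"
proof (rule Bochner_Integration.integrable_bound)
  show "integrable lborel (\<lambda>t. stable_weight a z t * B)"
    by (intro integrable_mult_left integrable_stable_weight assms)
  have "\<bar>stable_weight a z t * g t\<bar> \<le> \<bar>stable_weight a z t * B\<bar>" for t
  proof (cases "t > 0")
    case True
    then have "\<bar>g t\<bar> \<le> \<bar>B\<bar>" using assms(4)[of t] by linarith
    then show ?thesis by (simp add: abs_mult mult_left_mono)
  qed simp
  then show "AE t in lborel. norm (stable_weight a z t * g t) \<le> norm (stable_weight a z t * B)"
    by simp
qed measurable

section \<open>Differentiation under the integral sign\<close>

text \<open>First-order Taylor expansion of \<open>exp (- v)\<close> at \<open>u\<close>, with the second derivative bounded by its value at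
a common lower bound \<open>w\<close> of \<open>u\<close> and \<open>v\<close>. With \<open>d = v - u\<close>, both signs of \<open>d\<close> reduce to
\<open>exp x \<ge> 1 + x\<close>.\<close>

lemma exp_minus_taylor_remainder:
  fixes u v w :: real
  assumes "w \<le> u" "w \<le> v"
  shows "\<bar>exp (- v) - exp (- u) + (v - u) * exp (- u)\<bar> \<le> (v - u)\<^sup>2 * exp (- w)"
proof -
  define d where "d = v - u"
  have v: "exp (- v) = exp (- u) * exp (- d)" by (simp add: d_def exp_add[symmetric])
  have r: "exp (- v) - exp (- u) + (v - u) * exp (- u) = exp (- u) * (exp (- d) - (1 - d))"
    unfolding v by (simp add: d_def algebra_simps)
  have nonneg: "0 \<le> exp (- d) - (1 - d)" using exp_ge_add_one_self[of "- d"] by simp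
  have "exp (- u) * (exp (- d) - (1 - d)) \<le> d\<^sup>2 * exp (- w)"
  proof (cases "d \<ge> 0")
    case True
    have "exp (- d) \<le> 1 / (1 + d)"
      using True exp_ge_add_one_self[of d] by (simp add: exp_minus field_simps)
    also have "1 / (1 + d) = (1 - d) + d\<^sup>2 / (1 + d)"
      using True by (simp add: field_simps power2_eq_square)
    also have "\<dots> \<le> (1 - d) + d\<^sup>2 / 1"
      using True by (intro add_left_mono divide_left_mono) auto
    finally have "exp (- d) - (1 - d) \<le> d\<^sup>2" by simp
    then have "exp (- u) * (exp (- d) - (1 - d)) \<le> exp (- w) * d\<^sup>2"
      using assms nonneg by (intro mult_mono) auto
    then show ?thesis by (simp add: mult.commute)
  next
    case False
    have "exp (- u) * (exp (- d) - (1 - d)) = exp (- v) * (1 - (1 - d) * exp d)"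
      unfolding v by (simp add: algebra_simps exp_add[symmetric])
    also have "\<dots> \<le> exp (- v) * d\<^sup>2"
    proof -
      have "(1 - d) * (1 + d) \<le> (1 - d) * exp d"
        using False exp_ge_add_one_self[of d] by (intro mult_left_mono) auto
      then have "1 - (1 - d) * exp d \<le> d\<^sup>2"
        by (simp add: power2_eq_square algebra_simps)
      then show ?thesis by (intro mult_left_mono) auto
    qed
    also have "\<dots> \<le> exp (- w) * d\<^sup>2"
      using assms by (intro mult_right_mono) auto
    finally show ?thesis by (simp add: mult.commute)
  qed
  then show ?thesis using nonneg unfolding r by (simp add: d_def)
qed

lemma has_field_derivative_quadratic_remainder:
  fixes f :: "real \<Rightarrow> real"
  assumes "e > 0" "\<And>x'. \<bar>x' - x\<bar> < e \<Longrightarrow> \<bar>f x' - f x - D * (x' - x)\<bar> \<le> C * (x' - x)\<^sup>2"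
  shows "(f has_field_derivative D) (at x)"
  unfolding has_field_derivative_iff
proof (rule LIM_zero_cancel, rule Lim_null_comparison)
  show "\<forall>\<^sub>F x' in at x. norm ((f x' - f x) / (x' - x) - D) \<le> C * \<bar>x' - x\<bar>"
    unfolding eventually_at
  proof (intro exI[of _ e] conjI ballI impI)
    fix x' assume x': "x' \<noteq> x \<and> dist x' x < e"
    have "norm ((f x' - f x) / (x' - x) - D) = \<bar>f x' - f x - D * (x' - x)\<bar> / \<bar>x' - x\<bar>"
      using x' by (simp add: abs_divide[symmetric] diff_divide_distrib)
    also have "\<dots> \<le> C * (x' - x)\<^sup>2 / \<bar>x' - x\<bar>"
      using x' by (intro divide_right_mono assms) (auto simp: dist_real_def)
    also have "(x' - x)\<^sup>2 = \<bar>x' - x\<bar> * \<bar>x' - x\<bar>"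
      by (simp add: power2_eq_square)
    also have "C * (\<bar>x' - x\<bar> * \<bar>x' - x\<bar>) / \<bar>x' - x\<bar> = C * \<bar>x' - x\<bar>"
      using x' by (simp del: abs_mult_self_eq)
    finally show "norm ((f x' - f x) / (x' - x) - D) \<le> C * \<bar>x' - x\<bar>" .
  qed (rule assms)
  show "((\<lambda>x'. C * \<bar>x' - x\<bar>) \<longlongrightarrow> 0) (at x)"
    by (auto intro!: tendsto_eq_intros)
qed

text \<open>For \<open>x\<close> within \<open>z / 2\<close> of \<open>z\<close> the Taylor remainder of the integrand is at most
\<open>(x - z)\<^sup>2\<close> times the weight with exponent \<open>a + 2\<close> and parameter \<open>z / 2\<close>, because the variable of
the exponential is \<open>z / t\<close>. That weight is integrable and independent of \<open>x\<close>.\<close>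

lemma has_field_derivative_integral_stable_weight:
  assumes a: "a > 1" and z: "z > 0" and g: "g \<in> borel_measurable borel"
    and B: "\<And>t. t > 0 \<Longrightarrow> \<bar>g t\<bar> \<le> B"
  shows "((\<lambda>z. \<integral>t. stable_weight a z t * g t \<partial>lborel) has_field_derivative
           - (\<integral>t. stable_weight (a + 1) z t * g t \<partial>lborel)) (at z)"
proof -
  define S where "S b x = (\<integral>t. stable_weight b x t * g t \<partial>lborel)" for b x
  have int: "integrable lborel (\<lambda>t. stable_weight b x t * g t)" if "1 < b" "0 < x" for b x
    using integrable_stable_weight_mult[OF that g B] .
  have "\<bar>S a x - S a z - - S (a + 1) z * (x - z)\<bar>
      \<le> (B * (\<integral>t. stable_weight (a + 2) (z / 2) t \<partial>lborel)) * (x - z)\<^sup>2" if x: "\<bar>x - z\<bar> < z / 2" for x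
  proof -
    let ?r = "\<lambda>t. stable_weight a x t * g t - stable_weight a z t * g t + (x - z) * (stable_weight (a + 1) z t * g t)"
    have x0: "x > 0" "z / 2 \<le> x" using x z by (auto simp: abs_if split: if_splits)
    have i: "integrable lborel (\<lambda>t. stable_weight a x t * g t)"
      "integrable lborel (\<lambda>t. stable_weight a z t * g t)"
      "integrable lborel (\<lambda>t. (x - z) * (stable_weight (a + 1) z t * g t))"
      using a z x0 by (intro int integrable_mult_right; simp)+
    have pt: "\<bar>?r t\<bar> \<le> B * (x - z)\<^sup>2 * stable_weight (a + 2) (z / 2) t" for t
    proof (cases "t > 0")
      case t: True
      have "?r t = t powr (- a) * g t * (exp (- (x / t)) - exp (- (z / t)) + (x / t - z / t) * exp (- (z / t)))"
      proof -
        have "t powr (- (a + 1)) = t powr (- a) / t"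
          using t by (simp add: powr_diff)
        then show ?thesis using t by (simp add: stable_weight_def algebra_simps diff_divide_distrib)
      qed
      then have "\<bar>?r t\<bar> = t powr (- a) * \<bar>g t\<bar>
          * \<bar>exp (- (x / t)) - exp (- (z / t)) + (x / t - z / t) * exp (- (z / t))\<bar>"
        by (simp add: abs_mult)
      also have "\<dots> \<le> t powr (- a) * B * ((x / t - z / t)\<^sup>2 * exp (- (z / 2 / t)))"
        using t x0 z B[OF t] by (intro mult_mono exp_minus_taylor_remainder divide_right_mono) auto
      also have "\<dots> = B * (x - z)\<^sup>2 * stable_weight (a + 2) (z / 2) t"
      proof -
        have "t powr (- (a + 2)) = t powr (- a) / t powr 2"
          by (simp add: powr_diff[symmetric])
        then have "t powr (- (a + 2)) = t powr (- a) / t\<^sup>2"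
          using t by simp
        moreover have "(x / t - z / t)\<^sup>2 = (x - z)\<^sup>2 / t\<^sup>2"
          by (simp add: diff_divide_distrib[symmetric] power_divide)
        ultimately show ?thesis using t by (simp add: stable_weight_def)
      qed
      finally show ?thesis .
    qed simp
    have remainder: "S a x - S a z - - S (a + 1) z * (x - z) = (\<integral>t. ?r t \<partial>lborel)"
      unfolding S_def Bochner_Integration.integral_add[OF Bochner_Integration.integrable_diff[OF i(1,2)] i(3)]
        Bochner_Integration.integral_diff[OF i(1,2)] integral_mult_right_zero by simp
    have "\<bar>\<integral>t. ?r t \<partial>lborel\<bar> \<le> (\<integral>t. \<bar>?r t\<bar> \<partial>lborel)" by (rule integral_abs_bound)
    also have "\<dots> \<le> (\<integral>t. B * (x - z)\<^sup>2 * stable_weight (a + 2) (z / 2) t \<partial>lborel)"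
    proof (rule integral_mono)
      show "integrable lborel (\<lambda>t. \<bar>?r t\<bar>)"
        by (rule integrable_abs[OF Bochner_Integration.integrable_add[OF
              Bochner_Integration.integrable_diff[OF i(1,2)] i(3)]])
      show "integrable lborel (\<lambda>t. B * (x - z)\<^sup>2 * stable_weight (a + 2) (z / 2) t)"
        using a z by (intro integrable_mult_right integrable_stable_weight) auto
    qed (rule pt)
    finally show ?thesis unfolding remainder by (simp add: ac_simps)
  qed
  from has_field_derivative_quadratic_remainder[of "z / 2", OF _ this] show ?thesis
    using z by (simp add: S_def)
qed

section \<open>The Poisson kernel as a mixture of heat kernels\<close>

definition subordinate :: "real \<Rightarrow> real \<Rightarrow> (real \<Rightarrow> int \<Rightarrow> real) \<Rightarrow> int \<Rightarrow> real" where
  "subordinate a z f j = (\<integral>t. stable_weight a z t * f t j \<partial>lborel)"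

lemma delta_right_funpow_Suc_apply:
  "(delta_right ^^ Suc l) f j = (delta_right ^^ l) f j - (delta_right ^^ l) f (j + 1)"
  using delta_right_def[of "(delta_right ^^ l) f" j] by simp

lemma abs_delta_right_funpow_heat_kernel_le:
  assumes "t > 0"
  shows "\<bar>(delta_right ^^ l) (heat_kernel t) j\<bar> \<le> 2 ^ l"
  using l1_le_pointwise[OF l1_le_delta_right_funpow[OF l1_le_heat_kernel[of t], of l]] assms by simp

lemma borel_measurable_delta_right_funpow_heat_kernel [measurable]:
  "(\<lambda>t. (delta_right ^^ l) (heat_kernel t) j) \<in> borel_measurable borel"
proof (induction l arbitrary: j)
  case (Suc l)
  show ?case
    unfolding delta_right_funpow_Suc_apply by (intro borel_measurable_diff Suc.IH)
qed simp

lemma integrable_subordinate: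
  assumes "a > 1" "z > 0"
  shows "integrable lborel (\<lambda>t. stable_weight a z t * (delta_right ^^ l) (heat_kernel t) j)"
  by (rule integrable_stable_weight_mult[OF assms borel_measurable_delta_right_funpow_heat_kernel
        abs_delta_right_funpow_heat_kernel_le])

text \<open>Time decay \<open>t powr (- p)\<close> of the heat kernel merges into the weight and shifts its exponent from \<open>a\<close>
to \<open>a + p\<close>; scaling then gives the power of \<open>z\<close>.\<close>

lemma l1_le_subordinate:
  assumes a: "a > 1" and z: "z > 0"
    and c: "c \<ge> 0" "p \<ge> 0" "\<And>t. t > 0 \<Longrightarrow> l1_le ((delta_right ^^ l) (heat_kernel t)) (c * t powr (- p))"
  shows "l1_le (subordinate a z (\<lambda>t. (delta_right ^^ l) (heat_kernel t)))
    (c * (\<integral>t. stable_weight (a + p) 1 t \<partial>lborel) * z powr (1 - (a + p)))"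
proof -
  have bound: "l1_le (\<lambda>j. stable_weight a z t * (delta_right ^^ l) (heat_kernel t) j)
      (c * stable_weight (a + p) z t)" for t
  proof (cases "t > 0")
    case True
    have "stable_weight a z t * (c * t powr (- p)) = c * stable_weight (a + p) z t"
      using True by (simp add: stable_weight_def powr_add[symmetric])
    with l1_le_cmult[OF c(3)[OF True], of "stable_weight a z t"] show ?thesis by simp
  qed (simp add: l1_le_def)
  have "l1_le (subordinate a z (\<lambda>t. (delta_right ^^ l) (heat_kernel t)))
      (\<integral>t. c * stable_weight (a + p) z t \<partial>lborel)"
    unfolding subordinate_def
    using a z c(2)
    by (intro l1_le_integral bound integrable_subordinate integrable_mult_right
        integrable_stable_weight) auto
  then show ?thesis
    using integral_stable_weight[OF z, of "a + p"] by (simp add: ac_simps)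
qed

lemma poisson_kernel_eq_subordinate:
  assumes "y > 0"
  shows "poisson_kernel y j = y / (2 * sqrt pi) * subordinate (3 / 2) (y\<^sup>2 / 4) heat_kernel j"
  unfolding poisson_kernel_def subordinate_def set_lebesgue_integral_def
proof (intro arg_cong2[where f = "(*)"] Bochner_Integration.integral_cong refl)
  fix t :: real
  show "indicator {0<..} t *\<^sub>R (exp (- y\<^sup>2 / (4 * t)) / t powr (3 / 2) * heat_kernel t j)
      = stable_weight (3 / 2) (y\<^sup>2 / 4) t * heat_kernel t j"
    by (simp add: stable_weight_def powr_minus_divide indicator_def)
qed

lemma delta_right_funpow_poisson_kernel:
  assumes y: "y > 0"
  shows "(delta_right ^^ l) (poisson_kernel y) j
    = y / (2 * sqrt pi) * subordinate (3 / 2) (y\<^sup>2 / 4) (\<lambda>t. (delta_right ^^ l) (heat_kernel t)) j"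
proof (induction l arbitrary: j)
  case 0
  then show ?case by (simp add: poisson_kernel_eq_subordinate[OF y])
next
  case (Suc l)
  let ?f = "\<lambda>t. (delta_right ^^ l) (heat_kernel t)"
  have "subordinate (3 / 2) (y\<^sup>2 / 4) (\<lambda>t. (delta_right ^^ Suc l) (heat_kernel t)) j
      = (\<integral>t. stable_weight (3 / 2) (y\<^sup>2 / 4) t * ?f t j - stable_weight (3 / 2) (y\<^sup>2 / 4) t * ?f t (j + 1) \<partial>lborel)"
    by (simp only: subordinate_def delta_right_funpow_Suc_apply right_diff_distrib)
  also have "\<dots> = subordinate (3 / 2) (y\<^sup>2 / 4) ?f j - subordinate (3 / 2) (y\<^sup>2 / 4) ?f (j + 1)"
    unfolding subordinate_def
    by (rule Bochner_Integration.integral_diff) (use y in \<open>auto intro!: integrable_subordinate\<close>)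
  finally show ?case
    using Suc.IH by (simp only: delta_right_funpow_Suc_apply[of l "poisson_kernel y"] right_diff_distrib)
qed

lemma square_quarter_powr:
  assumes "y > 0"
  shows "(y\<^sup>2 / 4) powr (- real n / 2) = 2 ^ n * y powi (- int n)"
proof -
  have "y\<^sup>2 / 4 = (y / 2) powr 2"
    using assms by (simp add: power_divide)
  then have "(y\<^sup>2 / 4) powr (- real n / 2) = (y / 2) powr (- real n)"
    by (simp only: powr_powr) simp
  also have "\<dots> = 2 ^ n * y powi (- int n)"
    using assms by (simp add: powr_minus powr_realpow power_int_minus field_simps)
  finally show ?thesis .
qed

section \<open>Differences of the Poisson kernel\<close>

lemma l1_le_delta_right_funpow_poisson_kernel:
  "\<exists>C. \<forall>y>0. l1_le ((delta_right ^^ l) (poisson_kernel y)) (C * y powi (- int l))"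
proof -
  obtain c where c: "c \<ge> 0"
    "\<And>t. t > 0 \<Longrightarrow> l1_le ((delta_right ^^ l) (heat_kernel t)) (c * t powr (- real l / 2))"
    using l1_le_delta_right_funpow_heat_kernel by blast
  define M where "M = (\<integral>t. stable_weight (3 / 2 + real l / 2) 1 t \<partial>lborel)"
  have "l1_le ((delta_right ^^ l) (poisson_kernel y))
      (c * M * 2 ^ (l + 1) / (2 * sqrt pi) * y powi (- int l))" if y: "y > 0" for y
  proof -
    have "l1_le (subordinate (3 / 2) (y\<^sup>2 / 4) (\<lambda>t. (delta_right ^^ l) (heat_kernel t)))
        (c * M * (y\<^sup>2 / 4) powr (1 - (3 / 2 + real l / 2)))"
      unfolding M_def using y c by (intro l1_le_subordinate) auto
    also have "1 - (3 / 2 + real l / 2) = - real (l + 1) / 2" by (simp add: field_simps)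
    finally have "l1_le ((delta_right ^^ l) (poisson_kernel y))
        (\<bar>y / (2 * sqrt pi)\<bar> * (c * M * (2 ^ (l + 1) * y powi (- int (l + 1)))))"
      unfolding square_quarter_powr[OF y] delta_right_funpow_poisson_kernel[OF y, abs_def]
      by (rule l1_le_cmult)
    also have "\<bar>y / (2 * sqrt pi)\<bar> * (c * M * (2 ^ (l + 1) * y powi (- int (l + 1))))
        = c * M * 2 ^ (l + 1) / (2 * sqrt pi) * (y * y powi (- int (l + 1)))"
      using y by simp
    also have "y * y powi (- int (l + 1)) = y powi (- int l)"
      using y power_int_add[of y 1 "- int (l + 1)"] by simp
    finally show ?thesis .
  qed
  then show ?thesis by blast
qed

section \<open>Derivatives of the Poisson kernel\<close>

text \<open>The functions of \<open>(y, j)\<close> that are candidates for an \<open>m\<close>-th derivative of the Poisson kernel. The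
exponent of \<open>y\<close> in the generators makes each of them homogeneous of degree \<open>- m\<close> in the
\<open>\<ell>\<^sup>1\<close> norm, as mixing with exponent \<open>3 / 2 + b\<close> has norm of order \<open>y powi (- (2 b + 1))\<close>. Integer
powers are used because the exponent becomes negative.\<close>

inductive poisson_like :: "nat \<Rightarrow> (real \<Rightarrow> int \<Rightarrow> real) \<Rightarrow> bool" where
  basic: "poisson_like m
    (\<lambda>y j. y powi (2 * int b + 1 - int m) * subordinate (3 / 2 + real b) (y\<^sup>2 / 4) heat_kernel j)"
| cmult: "poisson_like m h \<Longrightarrow> poisson_like m (\<lambda>y j. c * h y j)"
| add: "poisson_like m h \<Longrightarrow> poisson_like m k \<Longrightarrow> poisson_like m (\<lambda>y j. h y j + k y j)"

lemma subordinate_has_field_derivative: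
  assumes "a > 1" "z > 0"
  shows "((\<lambda>z. subordinate a z heat_kernel j) has_field_derivative
      - subordinate (a + 1) z heat_kernel j) (at z)"
  unfolding subordinate_def
proof (rule has_field_derivative_integral_stable_weight[OF assms borel_measurable_heat_kernel])
  show "\<bar>heat_kernel t j\<bar> \<le> 1" if "t > 0" for t
    using abs_delta_right_funpow_heat_kernel_le[OF that, of 0 j] by simp
qed

text \<open>The product rule on a generator gives two generators of order \<open>m + 1\<close>: the power of \<open>y\<close> drops by one
with \<open>b\<close> kept, or the derivative falls on the mixture, which raises \<open>b\<close> by one and contributes the
inner derivative \<open>y / 2\<close> of \<open>y\<^sup>2 / 4\<close>.\<close>

lemma poisson_like_has_field_derivative:
  "poisson_like m h \<Longrightarrow> \<exists>h'. poisson_like (Suc m) h' \<and>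
     (\<forall>y>0. \<forall>j. ((\<lambda>x. h x j) has_field_derivative h' y j) (at y))"
proof (induction rule: poisson_like.induct)
  case (basic m b)
  define p where "p = 2 * int b + 1 - int m"
  define e where "e i = (\<lambda>y j. y powi (2 * int i + 1 - int (Suc m))
    * subordinate (3 / 2 + real i) (y\<^sup>2 / 4) heat_kernel j)" for i
  have "poisson_like (Suc m) (\<lambda>y j. of_int p * e b y j + (- 1 / 2) * e (Suc b) y j)"
    unfolding e_def by (rule poisson_like.add[OF poisson_like.cmult[OF poisson_like.basic]
          poisson_like.cmult[OF poisson_like.basic]])
  moreover have "((\<lambda>x. x powi p * subordinate (3 / 2 + real b) (x\<^sup>2 / 4) heat_kernel j)
      has_field_derivative of_int p * e b y j + (- 1 / 2) * e (Suc b) y j) (at y)"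
    if y: "y > 0" for y j
  proof -
    have "((\<lambda>x. subordinate (3 / 2 + real b) (x\<^sup>2 / 4) heat_kernel j)
        has_field_derivative - subordinate (3 / 2 + real b + 1) (y\<^sup>2 / 4) heat_kernel j * (y / 2)) (at y)"
    proof (rule DERIV_chain2[OF subordinate_has_field_derivative])
      show "((\<lambda>x. x\<^sup>2 / 4) has_field_derivative y / 2) (at y)"
        by (auto intro!: derivative_eq_intros)
    qed (use y in auto)
    moreover have "((\<lambda>x. x powi p) has_field_derivative of_int p * y powi (p - 1)) (at y)"
      using y by (auto intro!: derivative_eq_intros)
    ultimately have "((\<lambda>x. x powi p * subordinate (3 / 2 + real b) (x\<^sup>2 / 4) heat_kernel j)
        has_field_derivative y powi p * (- subordinate (3 / 2 + real b + 1) (y\<^sup>2 / 4) heat_kernel j * (y / 2))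
          + of_int p * y powi (p - 1) * subordinate (3 / 2 + real b) (y\<^sup>2 / 4) heat_kernel j) (at y)"
      by (rule DERIV_mult'[rotated])
    moreover have "e b y j = y powi (p - 1) * subordinate (3 / 2 + real b) (y\<^sup>2 / 4) heat_kernel j"
      by (simp add: e_def p_def)
    moreover have "e (Suc b) y j = y powi p * y * subordinate (3 / 2 + real b + 1) (y\<^sup>2 / 4) heat_kernel j"
    proof -
      have "2 * int (Suc b) + 1 - int (Suc m) = p + 1" by (simp add: p_def)
      moreover have "3 / 2 + real (Suc b) = 3 / 2 + real b + 1" by simp
      ultimately show ?thesis using y by (simp only: e_def) (simp add: power_int_add)
    qed
    ultimately show ?thesis by (simp add: algebra_simps)
  qed
  ultimately show ?case unfolding p_def by blast
next
  case (cmult m h c)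
  then obtain h' where "poisson_like (Suc m) h'"
    "\<forall>y>0. \<forall>j. ((\<lambda>x. h x j) has_field_derivative h' y j) (at y)" by blast
  then show ?case
    by (intro exI[of _ "\<lambda>y j. c * h' y j"]) (simp add: poisson_like.cmult DERIV_cmult)
next
  case (add m h k)
  from add.IH(1) obtain h' where h': "poisson_like (Suc m) h'"
    "\<forall>y>0. \<forall>j. ((\<lambda>x. h x j) has_field_derivative h' y j) (at y)" by blast
  from add.IH(2) obtain k' where k': "poisson_like (Suc m) k'"
    "\<forall>y>0. \<forall>j. ((\<lambda>x. k x j) has_field_derivative k' y j) (at y)" by blast
  from h' k' show ?case
    by (intro exI[of _ "\<lambda>y j. h' y j + k' y j"]) (simp add: poisson_like.add DERIV_add)
qed

lemma l1_le_poisson_like: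
  "poisson_like m h \<Longrightarrow> \<exists>C. \<forall>y>0. l1_le (h y) (C * y powi (- int m))"
proof (induction rule: poisson_like.induct)
  case (basic m b)
  define M where "M = (\<integral>t. stable_weight (3 / 2 + real b) 1 t \<partial>lborel)"
  have "l1_le (\<lambda>j. y powi (2 * int b + 1 - int m) * subordinate (3 / 2 + real b) (y\<^sup>2 / 4) heat_kernel j)
      (2 ^ (2 * b + 1) * M * y powi (- int m))" if y: "y > 0" for y
  proof -
    have "l1_le (subordinate (3 / 2 + real b) (y\<^sup>2 / 4) (\<lambda>t. (delta_right ^^ 0) (heat_kernel t)))
        (1 * (\<integral>t. stable_weight (3 / 2 + real b + 0) 1 t \<partial>lborel)
           * (y\<^sup>2 / 4) powr (1 - (3 / 2 + real b + 0)))"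
      using y l1_le_heat_kernel by (intro l1_le_subordinate) auto
    also have "1 - (3 / 2 + real b + 0) = - real (2 * b + 1) / 2" by (simp add: field_simps)
    finally have "l1_le (subordinate (3 / 2 + real b) (y\<^sup>2 / 4) heat_kernel)
        (M * (2 ^ (2 * b + 1) * y powi (- int (2 * b + 1))))"
      unfolding square_quarter_powr[OF y] by (simp add: M_def)
    from l1_le_cmult[OF this, of "y powi (2 * int b + 1 - int m)"]
    have "l1_le (\<lambda>j. y powi (2 * int b + 1 - int m) * subordinate (3 / 2 + real b) (y\<^sup>2 / 4) heat_kernel j)
        (2 ^ (2 * b + 1) * M * (y powi (2 * int b + 1 - int m) * y powi (- int (2 * b + 1))))"
      using y by (simp add: ac_simps)
    also have "y powi (2 * int b + 1 - int m) * y powi (- int (2 * b + 1)) = y powi (- int m)"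
      using y by (subst power_int_add[symmetric]) auto
    finally show ?thesis .
  qed
  then show ?case by blast
next
  case (cmult m h c)
  then obtain C where C: "\<forall>y>0. l1_le (h y) (C * y powi (- int m))" by blast
  have "l1_le (\<lambda>j. c * h y j) (\<bar>c\<bar> * C * y powi (- int m))" if "y > 0" for y
    using l1_le_cmult[of "h y" "C * y powi (- int m)" c] C that by (simp add: mult.assoc)
  then show ?case by blast
next
  case (add m h k)
  from add.IH(1) obtain C where C: "\<forall>y>0. l1_le (h y) (C * y powi (- int m))" by blast
  from add.IH(2) obtain D where D: "\<forall>y>0. l1_le (k y) (D * y powi (- int m))" by blast
  have "l1_le (\<lambda>j. h y j + k y j) ((C + D) * y powi (- int m))" if "y > 0" for y
    using l1_le_add[of "h y" "C * y powi (- int m)" "k y" "D * y powi (- int m)"] C D that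
    by (simp add: distrib_right)
  then show ?case by blast
qed

lemma has_field_derivative_eq_on_positive:
  fixes f g :: "real \<Rightarrow> real"
  assumes "\<And>x. x > 0 \<Longrightarrow> f x = g x" "(g has_field_derivative d) (at y)" "y > 0"
  shows "(f has_field_derivative d) (at y)"
  by (rule has_field_derivative_transform_within_open[OF assms(2), of "{0<..}"])
     (use assms in auto)

text \<open>The integral representation determines the derivatives for \<open>y > 0\<close> only. Since this half-line is
open, agreement there is enough to differentiate once more.\<close>

lemma higher_deriv_poisson_kernel:
  "\<exists>h. poisson_like m h \<and> (\<forall>y>0. \<forall>j. (deriv ^^ m) (\<lambda>x. poisson_kernel x j) y = h y j)"
proof (induction m)
  case 0
  let ?h = "\<lambda>y j. 1 / (2 * sqrt pi)
      * (y powi (2 * int 0 + 1 - int 0) * subordinate (3 / 2 + real 0) (y\<^sup>2 / 4) heat_kernel j)"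
  have "poisson_like 0 ?h"
    by (rule poisson_like.cmult[OF poisson_like.basic])
  moreover have "(deriv ^^ 0) (\<lambda>x. poisson_kernel x j) y = ?h y j" if "y > 0" for y j
    using that by (simp add: poisson_kernel_eq_subordinate)
  ultimately show ?case by (intro exI[of _ ?h]) simp
next
  case (Suc m)
  then obtain h where h: "poisson_like m h"
    "\<forall>y>0. \<forall>j. (deriv ^^ m) (\<lambda>x. poisson_kernel x j) y = h y j" by blast
  obtain h' where h': "poisson_like (Suc m) h'"
    "\<forall>y>0. \<forall>j. ((\<lambda>x. h x j) has_field_derivative h' y j) (at y)"
    using poisson_like_has_field_derivative[OF h(1)] by blast
  have "((deriv ^^ m) (\<lambda>x. poisson_kernel x j) has_field_derivative h' y j) (at y)" if "y > 0" for y j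
    by (rule has_field_derivative_eq_on_positive[of _ "\<lambda>x. h x j"])
       (simp_all only: h(2) h'(2) that)
  then have "\<forall>y>0. \<forall>j. (deriv ^^ Suc m) (\<lambda>x. poisson_kernel x j) y = h' y j"
    by (simp add: DERIV_imp_deriv)
  with h'(1) show ?case by (intro exI[of _ h'] conjI)
qed

lemma higher_deriv_poisson_kernel_differentiable:
  assumes "y > 0"
  shows "(deriv ^^ k) (\<lambda>x. poisson_kernel x j) field_differentiable at y"
proof -
  obtain h where h: "poisson_like k h"
    "\<forall>y>0. \<forall>j. (deriv ^^ k) (\<lambda>x. poisson_kernel x j) y = h y j"
    using higher_deriv_poisson_kernel by blast
  obtain h' where h': "\<forall>y>0. \<forall>j. ((\<lambda>x. h x j) has_field_derivative h' y j) (at y)"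
    using poisson_like_has_field_derivative[OF h(1)] by blast
  have "((deriv ^^ k) (\<lambda>x. poisson_kernel x j) has_field_derivative h' y j) (at y)"
    by (rule has_field_derivative_eq_on_positive[of _ "\<lambda>x. h x j"])
       (simp_all only: h(2) h' assms)
  then show ?thesis unfolding field_differentiable_def by (rule exI)
qed

lemma l1_le_higher_deriv_poisson_kernel:
  "\<exists>C. \<forall>y>0. l1_le (\<lambda>j. (deriv ^^ m) (\<lambda>x. poisson_kernel x j) y) (C * y powi (- int m))"
proof -
  obtain h where h: "poisson_like m h"
    "\<forall>y>0. \<forall>j. (deriv ^^ m) (\<lambda>x. poisson_kernel x j) y = h y j"
    using higher_deriv_poisson_kernel by blast
  from l1_le_poisson_like[OF h(1)] show ?thesis
    using h(2) by simp
qed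

section \<open>The norm estimates\<close>

lemma l1_le_positive_constant:
  assumes "\<exists>C. \<forall>y>0. l1_le (f y) (C * y powi n)"
  shows "\<exists>C>0. \<forall>y>0. l1_le (f y) (C * y powi n)"
proof -
  obtain C where C: "\<forall>y>0. l1_le (f y) (C * y powi n)" using assms by blast
  have "l1_le (f y) (max C 1 * y powi n)" if "y > 0" for y
  proof (rule l1_le_mono)
    show "l1_le (f y) (C * y powi n)" using C that by blast
    show "C * y powi n \<le> max C 1 * y powi n"
      using that by (intro mult_right_mono) simp_all
  qed
  then show ?thesis by (intro exI[of _ "max C 1"] conjI allI impI) simp_all
qed

theorem lemma9:
  shows "(\<forall>m::nat. \<exists>C::real. C > 0 \<and> (\<forall>y::real. y > 0 \<longrightarrow>
           (\<forall>j::int. \<forall>k<m. (deriv ^^ k) (\<lambda>x. poisson_kernel x j) field_differentiable at y) \<and>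
           (\<lambda>j::int. \<bar>(deriv ^^ m) (\<lambda>x. poisson_kernel x j) y\<bar>) summable_on UNIV \<and>
           (\<Sum>\<^sub>\<infinity>j::int. \<bar>(deriv ^^ m) (\<lambda>x. poisson_kernel x j) y\<bar>) \<le> C * y powi (- int m)))
       \<and> (\<forall>l::nat. \<exists>C::real. C > 0 \<and> (\<forall>y::real. y > 0 \<longrightarrow>
           (\<lambda>j::int. \<bar>(delta_right ^^ l) (poisson_kernel y) j\<bar>) summable_on UNIV \<and>
           (\<Sum>\<^sub>\<infinity>j::int. \<bar>(delta_right ^^ l) (poisson_kernel y) j\<bar>) \<le> C * y powi (- int l)))"
proof (intro conjI allI)
  fix m :: nat
  obtain C where C: "C > 0"
    "\<forall>y>0. l1_le (\<lambda>j. (deriv ^^ m) (\<lambda>x. poisson_kernel x j) y) (C * y powi (- int m))"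
    using l1_le_positive_constant[OF l1_le_higher_deriv_poisson_kernel[of m]] by (elim exE conjE)
  show "\<exists>C::real. C > 0 \<and> (\<forall>y::real. y > 0 \<longrightarrow>
           (\<forall>j::int. \<forall>k<m. (deriv ^^ k) (\<lambda>x. poisson_kernel x j) field_differentiable at y) \<and>
           (\<lambda>j::int. \<bar>(deriv ^^ m) (\<lambda>x. poisson_kernel x j) y\<bar>) summable_on UNIV \<and>
           (\<Sum>\<^sub>\<infinity>j::int. \<bar>(deriv ^^ m) (\<lambda>x. poisson_kernel x j) y\<bar>) \<le> C * y powi (- int m))"
  proof (rule exI[of _ C], intro conjI allI impI)
    fix y :: real assume y: "y > 0"
    note bound = C(2)[rule_format, OF y]
    show "(\<lambda>j. \<bar>(deriv ^^ m) (\<lambda>x. poisson_kernel x j) y\<bar>) summable_on UNIV"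
      by (rule l1_le_summable_on[OF bound])
    show "(\<Sum>\<^sub>\<infinity>j. \<bar>(deriv ^^ m) (\<lambda>x. poisson_kernel x j) y\<bar>) \<le> C * y powi (- int m)"
      by (rule l1_le_infsum[OF bound])
    show "(deriv ^^ k) (\<lambda>x. poisson_kernel x j) field_differentiable at y" for j k
      by (rule higher_deriv_poisson_kernel_differentiable[OF y])
  qed (rule C(1))
next
  fix l :: nat
  obtain C where C: "C > 0"
    "\<forall>y>0. l1_le ((delta_right ^^ l) (poisson_kernel y)) (C * y powi (- int l))"
    using l1_le_positive_constant[OF l1_le_delta_right_funpow_poisson_kernel[of l]] by (elim exE conjE)
  show "\<exists>C::real. C > 0 \<and> (\<forall>y::real. y > 0 \<longrightarrow>
           (\<lambda>j::int. \<bar>(delta_right ^^ l) (poisson_kernel y) j\<bar>) summable_on UNIV \<and>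
           (\<Sum>\<^sub>\<infinity>j::int. \<bar>(delta_right ^^ l) (poisson_kernel y) j\<bar>) \<le> C * y powi (- int l))"
  proof (rule exI[of _ C], intro conjI allI impI)
    fix y :: real assume y: "y > 0"
    note bound = C(2)[rule_format, OF y]
    show "(\<lambda>j. \<bar>(delta_right ^^ l) (poisson_kernel y) j\<bar>) summable_on UNIV"
      by (rule l1_le_summable_on[OF bound])
    show "(\<Sum>\<^sub>\<infinity>j. \<bar>(delta_right ^^ l) (poisson_kernel y) j\<bar>) \<le> C * y powi (- int l)"
      by (rule l1_le_infsum[OF bound])
  qed (rule C(1))
qed

end
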